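(* Let $(X,\varsigma)$ and $(Y,\tau)$ be locally solid lattices and let $T:X\to Y$ be a positive quasi $KB$ operator. Then each operator $S:X\to Y$ with $0\le S\le T$ is also quasi $KB$.
   Context: All vector spaces are real, operators are linear (not assumed continuous), vector topologies are Hausdorff, vector lattices are Archimedean. A locally solid lattice is a vector lattice with a linear topology having a base at zero of solid sets. An operator $T$ from a locally solid lattice $(X,\varsigma)$ to a topological vector space $(Y,\tau)$ is called quasi $KB$ if $T$ takes $\varsigma$-bounded increasing nets in $X_+$ to $\tau$-Cauchy nets. For operators, $0\le S\le T$ means that $S$ and $T-S$ are positive. *)

theory Defs
  imports "HOL-Analysis.Analysis" "HOL-Library.Lattice_Algebras"
begin

class topological_real_vector = real_vector + topological_ab_group_add + t2_space +
  assumes tendsto_scaleR_nhds: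
    "LIM p (nhds c \<times>\<^sub>F nhds a). fst p *\<^sub>R snd p :> nhds (c *\<^sub>R a)"

text \<open>The class \<^class>\<open>lattice_ab_group_add_abs\<close> contributes the lattice structure and
  the modulus \<open>\<bar>x\<bar> = sup x (- x)\<close>.\<close>

class vector_lattice = ordered_real_vector + lattice_ab_group_add_abs

class archimedean_vector_lattice = vector_lattice +
  assumes archimedean: "\<lbrakk>0 \<le> x; \<And>n::nat. real n *\<^sub>R x \<le> y\<rbrakk> \<Longrightarrow> x = 0"

definition (in vector_lattice) solid :: "'a set \<Rightarrow> bool" where
  "solid A \<longleftrightarrow> (\<forall>x y. y \<in> A \<longrightarrow> \<bar>x\<bar> \<le> \<bar>y\<bar> \<longrightarrow> x \<in> A)"

text \<open>The solid basic neighbourhoods of zero are not required to be open.\<close>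

class locally_solid_lattice = archimedean_vector_lattice + topological_real_vector +
  assumes solid_base_zero:
    "\<lbrakk>open U; 0 \<in> U\<rbrakk> \<Longrightarrow> \<exists>V. solid V \<and> V \<subseteq> U \<and> (\<exists>W. open W \<and> 0 \<in> W \<and> W \<subseteq> V)"

text \<open>Boundedness with respect to the linear topology; the library constant \<^const>\<open>bounded\<close>
  is the metric notion.\<close>

definition tvs_bounded :: "'a::topological_real_vector set \<Rightarrow> bool" where
  "tvs_bounded B \<longleftrightarrow>
    (\<forall>U. open U \<longrightarrow> 0 \<in> U \<longrightarrow> (\<exists>c>0. \<forall>x\<in>B. c *\<^sub>R x \<in> U))"

text \<open>A net is a function on a nonempty directed preordered set; \<open>(i, j) \<in> r\<close> means that
  \<open>j\<close> is later than or equal to \<open>i\<close>.\<close>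

definition directed_preorder :: "'i set \<Rightarrow> 'i rel \<Rightarrow> bool" where
  "directed_preorder I r \<longleftrightarrow>
    preorder_on I r \<and> I \<noteq> {} \<and> (\<forall>i\<in>I. \<forall>j\<in>I. \<exists>k\<in>I. (i, k) \<in> r \<and> (j, k) \<in> r)"

definition increasing_net :: "'i rel \<Rightarrow> ('i \<Rightarrow> 'a::order) \<Rightarrow> bool" where
  "increasing_net r x \<longleftrightarrow> (\<forall>(i, j)\<in>r. x i \<le> x j)"

definition Cauchy_net ::
    "'i set \<Rightarrow> 'i rel \<Rightarrow> ('i \<Rightarrow> 'a::topological_real_vector) \<Rightarrow> bool" where
  "Cauchy_net I r y \<longleftrightarrow>
    (\<forall>U. open U \<longrightarrow> 0 \<in> U \<longrightarrow>
      (\<exists>k\<in>I. \<forall>i j. (k, i) \<in> r \<longrightarrow> (k, j) \<in> r \<longrightarrow> y i - y j \<in> U))"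

text \<open>A HOL definition cannot quantify over the type of indices, so nets are indexed here
  by directed subsets of the type of \<open>X\<close>. Nothing is lost: the lemma following the
  definition gives the same property for nets over an arbitrary index type.\<close>

definition quasi_KB ::
    "('a::locally_solid_lattice \<Rightarrow> 'b::topological_real_vector) \<Rightarrow> bool" where
  "quasi_KB T \<longleftrightarrow>
    (\<forall>(I :: 'a set) r x. directed_preorder I r \<longrightarrow> increasing_net r x \<longrightarrow>
      x ` I \<subseteq> {0..} \<longrightarrow> tvs_bounded (x ` I) \<longrightarrow> Cauchy_net I r (\<lambda>i. T (x i)))"

lemma quasi_KB_all_nets:
  fixes T :: "'a::locally_solid_lattice \<Rightarrow> 'b::topological_real_vector"
    and I :: "'i set"
  assumes "quasi_KB T" and dir: "directed_preorder I r" and inc: "increasing_net r x"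
    and pos: "x ` I \<subseteq> {0..}" and bdd: "tvs_bounded (x ` I)"
  shows "Cauchy_net I r (\<lambda>i. T (x i))"
proof -
  define R where "R = {(a, b). a \<in> x ` I \<and> b \<in> x ` I \<and> a \<le> b}"
  have rI: "r \<subseteq> I \<times> I"
    using dir by (simp add: directed_preorder_def preorder_on_def)
  have mono: "x i \<le> x j" if "(i, j) \<in> r" for i j
    using inc that by (auto simp: increasing_net_def)
  have "preorder_on (x ` I) R"
    by (auto simp: preorder_on_def refl_on_def trans_def R_def)
  moreover have "\<exists>c\<in>x ` I. (a, c) \<in> R \<and> (b, c) \<in> R" if ab: "a \<in> x ` I" "b \<in> x ` I" for a b
  proof -
    obtain i j where ij: "i \<in> I" "j \<in> I" "a = x i" "b = x j"
      using ab by blast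
    then obtain k where "k \<in> I" "(i, k) \<in> r" "(j, k) \<in> r"
      using dir by (auto simp: directed_preorder_def)
    then show ?thesis
      using ij mono by (auto simp: R_def)
  qed
  ultimately have "directed_preorder (x ` I) R"
    using dir by (auto simp: directed_preorder_def)
  moreover have "increasing_net R (\<lambda>a. a)"
    by (auto simp: increasing_net_def R_def)
  moreover have "(\<lambda>a. a) ` x ` I \<subseteq> {0..}" "tvs_bounded ((\<lambda>a. a) ` x ` I)"
    using pos bdd by simp_all
  ultimately have C: "Cauchy_net (x ` I) R (\<lambda>a. T a)"
    using assms(1) unfolding quasi_KB_def by blast
  show ?thesis
    unfolding Cauchy_net_def
  proof (intro allI impI)
    fix U :: "'b set" assume "open U" "0 \<in> U"
    then obtain a where "a \<in> x ` I"
      and a: "\<And>b c. (a, b) \<in> R \<Longrightarrow> (a, c) \<in> R \<Longrightarrow> T b - T c \<in> U"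
      using C unfolding Cauchy_net_def by meson
    then obtain k where "k \<in> I" "a = x k"
      by blast
    then have "(a, x i) \<in> R" if "(k, i) \<in> r" for i
      using that rI mono by (auto simp: R_def)
    then show "\<exists>k\<in>I. \<forall>i j. (k, i) \<in> r \<longrightarrow> (k, j) \<in> r \<longrightarrow> T (x i) - T (x j) \<in> U"
      using a \<open>k \<in> I\<close> by blast
  qed
qed

definition positive_operator ::
    "('a::vector_lattice \<Rightarrow> 'b::vector_lattice) \<Rightarrow> bool" where
  "positive_operator T \<longleftrightarrow> linear T \<and> (\<forall>x\<ge>0. 0 \<le> T x)"

end

theory Submission
  imports Defs
begin

text \<open>Domination passes the Cauchy property from \<open>T\<close> to \<open>S\<close>. Let \<open>x\<close> be an increasing net.
  A tail of the Cauchy net \<open>T x\<^sub>i\<close> differs little from its value at some index \<open>k\<close>, and for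
  every \<open>i\<close> beyond \<open>k\<close> the increment \<open>x\<^sub>i - x\<^sub>k\<close> is positive, so that
  \<open>0 \<le> S x\<^sub>i - S x\<^sub>k \<le> T x\<^sub>i - T x\<^sub>k\<close>. Solid neighbourhoods of zero contain everything
  dominated by their members, hence \<open>S x\<^sub>i - S x\<^sub>k\<close> is small as well. The comparison works only
  between comparable indices; for two arbitrary indices beyond \<open>k\<close> one subtracts
  two such increments, which continuity of subtraction keeps small.\<close>

lemma zero_neighbourhood_diff:
  fixes U :: "'a::topological_ab_group_add set"
  assumes "open U" "0 \<in> U"
  obtains V where "open V" "0 \<in> V" "\<And>a b. a \<in> V \<Longrightarrow> b \<in> V \<Longrightarrow> a - b \<in> U"
proof -
  have "open ((\<lambda>p :: 'a \<times> 'a. fst p - snd p) -` U)"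
    by (intro open_vimage \<open>open U\<close> continuous_intros)
  moreover have "(0, 0) \<in> (\<lambda>p :: 'a \<times> 'a. fst p - snd p) -` U"
    using \<open>0 \<in> U\<close> by simp
  ultimately obtain A B where "open A" "open B" "(0, 0) \<in> A \<times> B"
      and sub: "A \<times> B \<subseteq> (\<lambda>p. fst p - snd p) -` U"
    by (rule open_prod_elim)
  then have "open (A \<inter> B)" "0 \<in> A \<inter> B"
    by auto
  moreover have "a - b \<in> U" if "a \<in> A \<inter> B" "b \<in> A \<inter> B" for a b
    using subsetD[OF sub, of "(a, b)"] that by simp
  ultimately show thesis
    by (rule that)
qed

text \<open>It suffices to compare a net with a single value of its own tail. This is the form in
  which an order estimate applies, since the members of a tail need not be comparable
  with each other.\<close>

lemma Cauchy_netI: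
  fixes y :: "'i \<Rightarrow> 'b::topological_real_vector"
  assumes "\<And>U. open U \<Longrightarrow> 0 \<in> U \<Longrightarrow> \<exists>k\<in>I. \<forall>i. (k, i) \<in> r \<longrightarrow> y i - y k \<in> U"
  shows "Cauchy_net I r y"
  unfolding Cauchy_net_def
proof (intro allI impI)
  fix U :: "'b set" assume "open U" "0 \<in> U"
  then obtain V where V: "open V" "0 \<in> V" "\<And>a b. a \<in> V \<Longrightarrow> b \<in> V \<Longrightarrow> a - b \<in> U"
    by (rule zero_neighbourhood_diff) blast
  obtain k where "k \<in> I" and k: "\<And>i. (k, i) \<in> r \<Longrightarrow> y i - y k \<in> V"
    using assms[OF V(1,2)] by blast
  have "y i - y j \<in> U" if "(k, i) \<in> r" "(k, j) \<in> r" for i j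
    using V(3)[OF k[OF that(1)] k[OF that(2)]] by simp
  then show "\<exists>k\<in>I. \<forall>i j. (k, i) \<in> r \<longrightarrow> (k, j) \<in> r \<longrightarrow> y i - y j \<in> U"
    using \<open>k \<in> I\<close> by blast
qed

lemma Cauchy_net_dominated:
  fixes y z :: "'i \<Rightarrow> 'b::locally_solid_lattice"
  assumes "Cauchy_net I r z" and refl: "refl_on I r"
    and dom: "\<And>i j. (i, j) \<in> r \<Longrightarrow> 0 \<le> y j - y i \<and> y j - y i \<le> z j - z i"
  shows "Cauchy_net I r y"
proof (rule Cauchy_netI)
  fix U :: "'b set" assume "open U" "0 \<in> U"
  then obtain V W where "solid V" "V \<subseteq> U" "open W" "0 \<in> W" "W \<subseteq> V"
    using solid_base_zero by blast
  then obtain k where "k \<in> I"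
      and k: "\<And>i j. (k, i) \<in> r \<Longrightarrow> (k, j) \<in> r \<Longrightarrow> z i - z j \<in> W"
    using assms(1) unfolding Cauchy_net_def by meson
  have "y i - y k \<in> U" if "(k, i) \<in> r" for i
  proof -
    have "(k, k) \<in> r"
      using refl \<open>k \<in> I\<close> by (rule refl_onD)
    then have "z i - z k \<in> V"
      using k[OF that] \<open>W \<subseteq> V\<close> by blast
    moreover have "\<bar>y i - y k\<bar> \<le> \<bar>z i - z k\<bar>"
      using dom[OF that] by (metis abs_of_nonneg order_trans)
    ultimately show ?thesis
      using \<open>solid V\<close> \<open>V \<subseteq> U\<close> unfolding solid_def by blast
  qed
  then show "\<exists>k\<in>I. \<forall>i. (k, i) \<in> r \<longrightarrow> y i - y k \<in> U"
    using \<open>k \<in> I\<close> by blast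
qed

theorem theorem2p6:
  fixes S T :: "'a::locally_solid_lattice \<Rightarrow> 'b::locally_solid_lattice"
  assumes "positive_operator T" and "quasi_KB T"
    and "linear S" and "positive_operator S" and "positive_operator (\<lambda>x. T x - S x)"
  shows "quasi_KB S"
  unfolding quasi_KB_def
proof (intro allI impI)
  fix I :: "'a set" and r and x :: "'a \<Rightarrow> 'a"
  assume net: "directed_preorder I r" "increasing_net r x"
    "x ` I \<subseteq> {0..}" "tvs_bounded (x ` I)"
  have "linear T"
    using assms(1) by (simp add: positive_operator_def)
  show "Cauchy_net I r (\<lambda>i. S (x i))"
  proof (rule Cauchy_net_dominated)
    show "Cauchy_net I r (\<lambda>i. T (x i))"
      using \<open>quasi_KB T\<close> net unfolding quasi_KB_def by blast
    show "refl_on I r"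
      using net(1) by (simp add: directed_preorder_def preorder_on_def)
    fix i j assume "(i, j) \<in> r"
    then have "0 \<le> x j - x i"
      using net(2) by (auto simp: increasing_net_def)
    then have "0 \<le> S (x j - x i)" "S (x j - x i) \<le> T (x j - x i)"
      using assms(4,5) by (auto simp: positive_operator_def)
    then show "0 \<le> S (x j) - S (x i) \<and> S (x j) - S (x i) \<le> T (x j) - T (x i)"
      by (simp only: linear_diff[OF \<open>linear S\<close>] linear_diff[OF \<open>linear T\<close>])
  qed
qed

end
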